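(* Let $E$ be a JB$^*$-triple in which tripotents are norm-total, and let $T:E\to E$ be a bounded linear map. The following are equivalent: (a) $T$ is a triple derivation; (b) $T$ is triple derivable at orthogonal pairs and, for each tripotent $e\in E$, the element $P_2(e)T(e)$ is skew-symmetric in the JB$^*$-algebra $E_2(e)$, i.e. $(P_2(e)T(e))^{*_e}=-P_2(e)T(e)$.
   Context: A JB$^*$-triple is a complex Banach space $E$ with a continuous triple product $\{\cdot,\cdot,\cdot\}$, bilinear and symmetric in the outer variables and conjugate-linear in the middle one, satisfying the Jordan identity $L(a,b)L(x,y)=L(x,y)L(a,b)+L(L(a,b)x,y)-L(x,L(b,a)y)$, such that $L(a,a)$ is hermitian with non-negative spectrum and $\|\{a,a,a\}\|=\|a\|^3$, where $L(a,b)x=\{a,b,x\}$. Elements $a,b$ are orthogonal ($a\perp b$) if $L(a,b)=0$. A linear map $T$ is triple derivable at orthogonal pairs if $\{T(a),b,c\}+\{a,T(b),c\}+\{a,b,T(c)\}=0$ for all $a,b,c$ with $a\perp b$. A triple derivation satisfies $\delta\{a,b,c\}=\{\delta a,b,c\}+\{a,\delta b,c\}+\{a,b,\delta c\}$. A tripotent is $e$ with $\{e,e,e\}=e$; $E_j(e)=\{x:\{e,e,x\}=\tfrac j2x\}$ ($j=0,1,2$), $E=E_2(e)\oplus E_1(e)\oplus E_0(e)$, with Peirce projections $P_j(e)$. $E_2(e)$ is a unital JB$^*$-algebra with unit $e$, product $x\circ_e y=\{x,e,y\}$ and involution $x^{*_e}=\{e,x,e\}$. Tripotents are norm-total in $E$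 if every element is a norm limit of finite linear combinations of mutually orthogonal tripotents. *)

theory Defs
  imports "HOL-Analysis.Analysis"
begin

text \<open>A complex Banach space is modelled as a real Banach space (type class banach)
together with a complex scalar multiplication cs extending the real one.\<close>

definition complex_scaling :: "(complex \<Rightarrow> 'a::banach \<Rightarrow> 'a) \<Rightarrow> bool" where
  "complex_scaling cs \<longleftrightarrow>
     (\<forall>r x. cs (complex_of_real r) x = r *\<^sub>R x) \<and>
     (\<forall>a b x. cs (a + b) x = cs a x + cs b x) \<and>
     (\<forall>a x y. cs a (x + y) = cs a x + cs a y) \<and>
     (\<forall>a b x. cs (a * b) x = cs a (cs b x)) \<and>
     (\<forall>a x. norm (cs a x) = cmod a * norm x)"

text \<open>Complex-linear maps E \<rightarrow> E and bounded ones.\<close>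
definition clinear_map :: "(complex \<Rightarrow> 'a::banach \<Rightarrow> 'a) \<Rightarrow> ('a \<Rightarrow> 'a) \<Rightarrow> bool" where
  "clinear_map cs f \<longleftrightarrow> (\<forall>x y. f (x + y) = f x + f y) \<and> (\<forall>a x. f (cs a x) = cs a (f x))"

definition bounded_clinear_map :: "(complex \<Rightarrow> 'a::banach \<Rightarrow> 'a) \<Rightarrow> ('a \<Rightarrow> 'a) \<Rightarrow> bool" where
  "bounded_clinear_map cs f \<longleftrightarrow> clinear_map cs f \<and> (\<exists>K. \<forall>x. norm (f x) \<le> K * norm x)"

text \<open>Norm-one-bounded complex-linear functionals (elements of the closed unit ball of the dual).\<close>
definition dual_ball :: "(complex \<Rightarrow> 'a::banach \<Rightarrow> 'a) \<Rightarrow> ('a \<Rightarrow> complex) \<Rightarrow> bool" where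
  "dual_ball cs f \<longleftrightarrow> (\<forall>x y. f (x + y) = f x + f y) \<and> (\<forall>a x. f (cs a x) = a * f x)
      \<and> (\<forall>x. cmod (f x) \<le> norm x)"

text \<open>Hermitian operator: its (spatial) numerical range
  V(S) = {f(Sx) : norm x = 1, norm f = 1, f x = 1} is contained in the reals.\<close>
definition hermitian_op :: "(complex \<Rightarrow> 'a::banach \<Rightarrow> 'a) \<Rightarrow> ('a \<Rightarrow> 'a) \<Rightarrow> bool" where
  "hermitian_op cs S \<longleftrightarrow> bounded_clinear_map cs S \<and>
     (\<forall>x f. norm x = 1 \<and> dual_ball cs f \<and> f x = 1 \<longrightarrow> Im (f (S x)) = 0)"

text \<open>Spectrum of an operator in the Banach algebra of bounded operators on E.\<close>
definition op_spectrum :: "(complex \<Rightarrow> 'a::banach \<Rightarrow> 'a) \<Rightarrow> ('a \<Rightarrow> 'a) \<Rightarrow> complex set" where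
  "op_spectrum cs S = {z. \<not> (\<exists>R. bounded_clinear_map cs R \<and>
        (\<forall>x. R (cs z x - S x) = x) \<and> (\<forall>x. cs z (R x) - S (R x) = x))}"

definition jbstar_triple :: "(complex \<Rightarrow> 'a::banach \<Rightarrow> 'a) \<Rightarrow> ('a \<Rightarrow> 'a \<Rightarrow> 'a \<Rightarrow> 'a) \<Rightarrow> bool" where
  "jbstar_triple cs tp \<longleftrightarrow>
     complex_scaling cs \<and>
     \<comment> \<open>linear in the first variable\<close>
     (\<forall>a a' b c. tp (a + a') b c = tp a b c + tp a' b c) \<and>
     (\<forall>\<mu> a b c. tp (cs \<mu> a) b c = cs \<mu> (tp a b c)) \<and>
     \<comment> \<open>conjugate-linear in the middle variable\<close>
     (\<forall>a b b' c. tp a (b + b') c = tp a b c + tp a b' c) \<and>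
     (\<forall>\<mu> a b c. tp a (cs \<mu> b) c = cs (cnj \<mu>) (tp a b c)) \<and>
     \<comment> \<open>symmetric in the outer variables (hence also linear in the third)\<close>
     (\<forall>a b c. tp a b c = tp c b a) \<and>
     \<comment> \<open>continuity\<close>
     continuous_on UNIV (\<lambda>(a, b, c). tp a b c) \<and>
     \<comment> \<open>Jordan identity L(a,b)L(x,y) = L(x,y)L(a,b) + L(L(a,b)x,y) - L(x,L(b,a)y)\<close>
     (\<forall>a b x y z. tp a b (tp x y z) =
         tp x y (tp a b z) + tp (tp a b x) y z - tp x (tp b a y) z) \<and>
     \<comment> \<open>L(a,a) hermitian with non-negative spectrum\<close>
     (\<forall>a. hermitian_op cs (tp a a)) \<and>
     (\<forall>a. op_spectrum cs (tp a a) \<subseteq> complex_of_real ` {0..}) \<and>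
     \<comment> \<open>C*-identity\<close>
     (\<forall>a. norm (tp a a a) = norm a ^ 3)"

definition triple_orth :: "('a::banach \<Rightarrow> 'a \<Rightarrow> 'a \<Rightarrow> 'a) \<Rightarrow> 'a \<Rightarrow> 'a \<Rightarrow> bool" where
  "triple_orth tp a b \<longleftrightarrow> (\<forall>x. tp a b x = 0)"

definition tripotent :: "('a::banach \<Rightarrow> 'a \<Rightarrow> 'a \<Rightarrow> 'a) \<Rightarrow> 'a \<Rightarrow> bool" where
  "tripotent tp e \<longleftrightarrow> tp e e e = e"

definition triple_derivable_orth ::
  "('a::banach \<Rightarrow> 'a \<Rightarrow> 'a \<Rightarrow> 'a) \<Rightarrow> ('a \<Rightarrow> 'a) \<Rightarrow> bool" where
  "triple_derivable_orth tp T \<longleftrightarrow>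
     (\<forall>a b c. triple_orth tp a b \<longrightarrow> tp (T a) b c + tp a (T b) c + tp a b (T c) = 0)"

definition triple_derivation ::
  "('a::banach \<Rightarrow> 'a \<Rightarrow> 'a \<Rightarrow> 'a) \<Rightarrow> ('a \<Rightarrow> 'a) \<Rightarrow> bool" where
  "triple_derivation tp T \<longleftrightarrow>
     (\<forall>a b c. T (tp a b c) = tp (T a) b c + tp a (T b) c + tp a b (T c))"

text \<open>Peirce subspaces E_j(e) = {x. {e,e,x} = (j/2) x}.\<close>
definition peirce_space :: "(complex \<Rightarrow> 'a::banach \<Rightarrow> 'a) \<Rightarrow> ('a \<Rightarrow> 'a \<Rightarrow> 'a \<Rightarrow> 'a) \<Rightarrow> nat \<Rightarrow> 'a \<Rightarrow> 'a set" where
  "peirce_space cs tp j e = {x. tp e e x = cs (of_nat j / 2) x}"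

text \<open>Peirce projection P_2(e): the E_2(e)-component in E = E_2(e) + E_1(e) + E_0(e).\<close>
definition peirce_P2 :: "(complex \<Rightarrow> 'a::banach \<Rightarrow> 'a) \<Rightarrow> ('a \<Rightarrow> 'a \<Rightarrow> 'a \<Rightarrow> 'a) \<Rightarrow> 'a \<Rightarrow> 'a \<Rightarrow> 'a" where
  "peirce_P2 cs tp e x = (THE y. y \<in> peirce_space cs tp 2 e \<and>
      (\<exists>y1 y0. y1 \<in> peirce_space cs tp 1 e \<and> y0 \<in> peirce_space cs tp 0 e \<and> x = y + y1 + y0))"

text \<open>Involution of the JB*-algebra E_2(e): x^{*e} = {e,x,e}.\<close>
definition peirce_star :: "('a::banach \<Rightarrow> 'a \<Rightarrow> 'a \<Rightarrow> 'a) \<Rightarrow> 'a \<Rightarrow> 'a \<Rightarrow> 'a" where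
  "peirce_star tp e x = tp e x e"

text \<open>Tripotents are norm-total.\<close>
definition tripotents_norm_total :: "(complex \<Rightarrow> 'a::banach \<Rightarrow> 'a) \<Rightarrow> ('a \<Rightarrow> 'a \<Rightarrow> 'a \<Rightarrow> 'a) \<Rightarrow> bool" where
  "tripotents_norm_total cs tp \<longleftrightarrow>
     (\<forall>x. x \<in> closure {y. \<exists>(n::nat) (c::nat \<Rightarrow> complex) (u::nat \<Rightarrow> 'a).
          (\<forall>i<n. tripotent tp (u i)) \<and>
          (\<forall>i<n. \<forall>j<n. i \<noteq> j \<longrightarrow> triple_orth tp (u i) (u j)) \<and>
          y = (\<Sum>i<n. cs (c i) (u i))})"

end

theory Submission
  imports Defs
begin

text \<open>The derivation defect \<open>D a b c = T {a,b,c} - {T a,b,c} - {a,T b,c} - {a,b,T c}\<close> has the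
same symmetry and sesquilinearity as the triple product, so by polarization it vanishes as soon as
\<open>D a a a = 0\<close> for all \<open>a\<close>, and by density and continuity it is enough to take \<open>a\<close> a finite
combination of orthogonal tripotents. Derivability at orthogonal pairs kills all mixed terms and
leaves \<open>D e e e = 0\<close> for a tripotent \<open>e\<close>, which says that \<open>P\<^sub>2(e) T e\<close> is skew-symmetric and
that \<open>b = P\<^sub>0(e) T e\<close> is zero. The latter follows by applying \<open>P\<^sub>0(e)\<close> to the derivability
identity for the orthogonal pair \<open>e, b\<close> at \<open>c = b\<close>: this yields \<open>{b,b,b} = 0\<close>.\<close>

section \<open>Triple forms and polarization\<close>

text \<open>Only the algebraic laws shared by the triple product and its derivation defect, so that
  polarization applies to both.\<close>

locale triple_form =
  fixes cs :: "complex \<Rightarrow> 'a::banach \<Rightarrow> 'a" and tp :: "'a \<Rightarrow> 'a \<Rightarrow> 'a \<Rightarrow> 'a"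
  assumes scaling: "complex_scaling cs"
    and add1: "tp (a + a') b c = tp a b c + tp a' b c"
    and cs1: "tp (cs \<mu> a) b c = cs \<mu> (tp a b c)"
    and add2: "tp a (b + b') c = tp a b c + tp a b' c"
    and cs2: "tp a (cs \<mu> b) c = cs (cnj \<mu>) (tp a b c)"
    and sym: "tp a b c = tp c b a"
begin

lemma cs_real: "cs (complex_of_real r) x = r *\<^sub>R x"
  and cs_add: "cs \<mu> (x + y) = cs \<mu> x + cs \<mu> y"
  and cs_add_left: "cs (\<mu> + \<nu>) x = cs \<mu> x + cs \<nu> x"
  and cs_mult: "cs (\<mu> * \<nu>) x = cs \<mu> (cs \<nu> x)"
  using scaling by (simp_all add: complex_scaling_def)

lemma cs_zero: "cs \<mu> 0 = 0"
  using cs_add[of \<mu> 0 0] by simp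

lemma add3: "tp a b (c + c') = tp a b c + tp a b c'"
  by (metis add1 sym)

lemma scaleR1: "tp (r *\<^sub>R a) b c = r *\<^sub>R tp a b c"
  by (metis cs1 cs_real)

lemma scaleR2: "tp a (r *\<^sub>R b) c = r *\<^sub>R tp a b c"
  by (metis cs2 cs_real complex_cnj_complex_of_real)

lemma scaleR3: "tp a b (r *\<^sub>R c) = r *\<^sub>R tp a b c"
  by (metis scaleR1 sym)

lemma linear1: "linear (\<lambda>a. tp a b c)"
  and linear2: "linear (\<lambda>b. tp a b c)"
  and linear3: "linear (\<lambda>c. tp a b c)"
  by (simp_all add: linear_iff add1 add2 add3 scaleR1 scaleR2 scaleR3)

lemmas diff1 = linear_diff[OF linear1] and diff2 = linear_diff[OF linear2]
  and diff3 = linear_diff[OF linear3]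

lemmas zero1 = linear_0[OF linear1] and zero2 = linear_0[OF linear2]
  and zero3 = linear_0[OF linear3]

lemmas linear_simps = add1 add2 add3 diff1 diff2 diff3 scaleR1 scaleR2 scaleR3 zero1 zero2 zero3

text \<open>Adding the cubes at \<open>x + y\<close> and \<open>x - y\<close> isolates the terms
  quadratic in \<open>y\<close>. Replacing \<open>x\<close> by \<open>cs \<i> x\<close> multiplies
  the two kinds of terms by opposite factors, as the middle variable is conjugate-linear, and so
  separates them. Finally \<open>a + c\<close> polarizes the outer variables.\<close>

lemma polarization:
  assumes cube: "\<And>a. tp a a a = 0"
  shows "tp a b c = 0"
proof -
  have even: "tp y x y + 2 *\<^sub>R tp x y y = 0" for x y
  proof -
    have "tp (x + y) (x + y) (x + y) + tp (x - y) (x - y) (x - y)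
        = 2 *\<^sub>R (tp y x y + 2 *\<^sub>R tp x y y)"
      using cube[of x] cube[of y] sym[of y x x] sym[of y y x]
      by (simp add: linear_simps algebra_simps scaleR_2 flip: scaleR_add_left)
    then show ?thesis
      by (simp add: cube)
  qed
  have diag: "tp y x y = 0" for x y
  proof -
    have "tp y (cs \<i> x) y + 2 *\<^sub>R tp (cs \<i> x) y y = cs \<i> (2 *\<^sub>R tp x y y - tp y x y)"
    proof -
      have "cs (- \<i>) z = - cs \<i> z" for z
        using cs_add_left[of "\<i>" "-\<i>" z] cs_real[of 0 z] by (simp add: eq_neg_iff_add_eq_0 add.commute)
      moreover have "cs \<i> (u - v) = cs \<i> u - cs \<i> v" for u v
        using cs_add[of \<i> "u - v" v] by (simp add: algebra_simps)
      ultimately show ?thesis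
        by (simp add: cs1 cs2 cs_add scaleR_2)
    qed
    then have "cs \<i> (cs \<i> (2 *\<^sub>R tp x y y - tp y x y)) = 0"
      by (simp add: even cs_zero)
    then have "2 *\<^sub>R tp x y y = tp y x y"
      using cs_mult[of \<i> \<i>] cs_real[of "-1"] by simp
    with even[of y x] have "2 *\<^sub>R tp y x y = 0"
      by (simp add: scaleR_2)
    then show ?thesis by simp
  qed
  have "2 *\<^sub>R tp a b c = 0"
    using diag[of "a + c" b] diag[of a b] diag[of c b] sym[of c b a]
    by (simp add: linear_simps scaleR_2)
  then show ?thesis by simp
qed

lemma cube_of_combination_eq_0:
  assumes off: "\<And>i j c. i \<in> I \<Longrightarrow> j \<in> I \<Longrightarrow> i \<noteq> j \<Longrightarrow> tp (u i) (u j) c = 0"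
    and diag: "\<And>i. i \<in> I \<Longrightarrow> tp (u i) (u i) (u i) = 0"
  shows "tp (\<Sum>i\<in>I. cs (\<alpha> i) (u i)) (\<Sum>i\<in>I. cs (\<alpha> i) (u i)) (\<Sum>i\<in>I. cs (\<alpha> i) (u i)) = 0"
proof -
  \<comment> \<open>If \<open>j\<close> differs from \<open>i\<close> use \<open>off\<close>; if it
    differs from \<open>k\<close> use \<open>off\<close> after swapping the outer variables;
    otherwise all indices agree.\<close>
  have basis: "tp (u i) (u j) (u k) = 0" if "i \<in> I" "j \<in> I" "k \<in> I" for i j k
    using off diag that sym[of "u i" "u j" "u k"] by metis
  have cs3: "tp a b (cs \<mu> c) = cs \<mu> (tp a b c)" for a b c \<mu>
    by (metis cs1 sym)
  show ?thesis
    by (simp add: linear_sum[OF linear1] linear_sum[OF linear2] linear_sum[OF linear3]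
        cs1 cs2 cs3 basis cs_zero)
qed

end

lemma scaleR_3: "3 *\<^sub>R x = x + x + x" for x :: "'a::real_vector"
  using scaleR_add_left[of 2 1 x] by (simp add: scaleR_2)

lemma scaleR_4: "4 *\<^sub>R x = x + x + x + x" for x :: "'a::real_vector"
  using scaleR_add_left[of 2 2 x] by (simp add: scaleR_2 add.assoc)

section \<open>Peirce calculus for a tripotent\<close>

locale jordan_triple = triple_form +
  assumes jordan: "tp a b (tp x y z) = tp x y (tp a b z) + tp (tp a b x) y z - tp x (tp b a y) z"

locale jordan_tripotent = jordan_triple +
  fixes e
  assumes tripotent: "tp e e e = e"
begin

definition L where "L x = tp e e x"
definition Q where "Q x = tp e x e"
text \<open>\<open>P1\<close> and \<open>P0\<close> are the Lagrange polynomials 4t(1-t) and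
  (1-t)(1-2t) in \<open>L\<close> for the eigenvalues 0, 1/2, 1; the remaining one, t(2t-1), will
  turn out to be \<open>Q\<close> applied twice.\<close>

definition P1 where "P1 x = 4 *\<^sub>R L x - 4 *\<^sub>R L (L x)"
definition P0 where "P0 x = x - 3 *\<^sub>R L x + 2 *\<^sub>R L (L x)"

section \<open>Polynomial identities between \<open>L\<close> and \<open>Q\<close>\<close>

lemma L_linear: "linear L" and Q_linear: "linear Q"
  using linear2 linear3 by (simp_all add: linear_iff L_def Q_def)

lemmas LQ_simps = linear_add[OF L_linear] linear_diff[OF L_linear] linear_scale[OF L_linear]
  linear_neg[OF L_linear] linear_neg[OF Q_linear]
  linear_add[OF Q_linear] linear_diff[OF Q_linear] linear_scale[OF Q_linear]

lemma L_triple: "L (tp x y z) = tp (L x) y z - tp x (L y) z + tp x y (L z)"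
  using jordan[of e e x y z] by (simp add: L_def algebra_simps)

lemma L_Q_eq: "L (Q x) = 2 *\<^sub>R Q x - Q (L x)"
  using L_triple[of e x e] tripotent by (simp add: Q_def L_def scaleR_2 algebra_simps)

text \<open>The Jordan identity gives two linear relations between \<open>Q x\<close>,
  \<open>L (Q x)\<close> and \<open>Q (L x)\<close>; eliminating the last leaves the claim.\<close>

lemma L_Q: "L (Q x) = Q x"
proof -
  have "Q x = 2 *\<^sub>R L (Q x) - Q (L x)"
    using jordan[of e x e e e] sym[of "tp e x e" e e] sym[of x e e]
    by (simp add: tripotent Q_def L_def scaleR_2)
  moreover have "Q (L x) = 2 *\<^sub>R Q x - L (Q x)"
    by (simp add: L_Q_eq)
  ultimately have "Q x = 3 *\<^sub>R L (Q x) - 2 *\<^sub>R Q x"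
    by (simp add: scaleR_2 scaleR_3 algebra_simps)
  then have "3 *\<^sub>R L (Q x) = 3 *\<^sub>R Q x"
    by (simp add: scaleR_2 scaleR_3 algebra_simps)
  then show ?thesis by simp
qed

lemma Q_L: "Q (L x) = Q x"
  using L_Q_eq[of x] by (simp add: L_Q scaleR_2)

lemma Q_Q: "Q (Q x) = 2 *\<^sub>R L (L x) - L x"
  using jordan[of x e e e e] sym[of x e e] sym[of "tp x e e" e e]
  by (simp add: tripotent Q_def L_def scaleR_2 algebra_simps)

text \<open>This is t(2t-1)(t-1) = 0 at t = \<open>L\<close>: the factor t(2t-1) is \<open>Q\<close>
  applied twice, and \<open>L\<close> fixes the range of \<open>Q\<close>.\<close>

lemma L_cubic: "2 *\<^sub>R L (L (L x)) = 3 *\<^sub>R L (L x) - L x"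
proof -
  have "L (Q (Q x)) = Q (Q x)"
    by (rule L_Q)
  then show ?thesis
    by (simp add: Q_Q LQ_simps algebra_simps scaleR_2 scaleR_3)
qed

lemma L_P0: "L (P0 x) = 0"
  by (simp add: P0_def LQ_simps L_cubic)

lemma L_P1: "L (P1 x) = (1/2) *\<^sub>R P1 x"
proof -
  have "2 *\<^sub>R L (P1 x) = 4 *\<^sub>R (2 *\<^sub>R L (L x)) - 4 *\<^sub>R (2 *\<^sub>R L (L (L x)))"
    by (simp add: P1_def LQ_simps scaleR_diff_right)
  also have "\<dots> = P1 x"
    by (simp only: L_cubic P1_def) (simp add: algebra_simps scaleR_2 scaleR_3 scaleR_4)
  finally have "(1/2) *\<^sub>R (2 *\<^sub>R L (P1 x)) = (1/2) *\<^sub>R P1 x"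
    by simp
  then show ?thesis by simp
qed

lemma peirce_decomposition: "x = Q (Q x) + P1 x + P0 x"
  by (simp add: Q_Q P1_def P0_def algebra_simps scaleR_2 scaleR_3 scaleR_4)

section \<open>Orthogonality relations for elements of the Peirce space of index 0\<close>

lemma Q_eq_0: "L b = 0 \<Longrightarrow> Q b = 0"
  by (metis Q_L linear_0[OF Q_linear])

text \<open>One instance of the Jordan identity says that \<open>L\<close> commutes with
  \<open>tp e b\<close>, another that their commutator is \<open>tp e b\<close> itself.\<close>

lemma orth_right:
  assumes "L b = 0" shows "tp e b x = 0"
proof -
  have "L (tp e b x) = tp e b (L x) + tp e b x"
    using L_triple[of e b x] assms tripotent by (simp add: L_def linear_simps)
  moreover have "tp e b (L x) = L (tp e b x)"
    using jordan[of e b e e x] Q_eq_0[OF assms] assms sym[of b e e]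
    by (simp add: L_def Q_def linear_simps)
  ultimately show ?thesis by simp
qed

lemma orth_left:
  assumes "L b = 0" shows "tp b e x = 0"
proof -
  have "L (tp b e x) = tp b e (L x) - tp b e x"
    using L_triple[of b e x] assms tripotent by (simp add: L_def linear_simps)
  moreover have "tp b e (L x) = L (tp b e x)"
    using jordan[of b e e e x] Q_eq_0[OF assms] assms sym[of b e e]
    by (simp add: L_def Q_def linear_simps)
  ultimately show ?thesis by simp
qed

text \<open>Every other term of the Jordan identity for \<open>tp r e\<close> and
  \<open>tp b e\<close> contains the zero operator \<open>tp b e\<close>. As \<open>Q\<close> maps
  onto the Peirce space of index 2, that space is orthogonal to \<open>b\<close>.\<close>

lemma orth_Q:
  assumes "L b = 0" shows "tp b (Q r) x = 0"
  using jordan[of r e b e x] orth_left[OF assms] sym[of r e b]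
  by (simp add: Q_def linear_simps)

text \<open>Only the component of \<open>s\<close> in the Peirce space of index 1 contributes to \<open>{b,s,e}\<close>, and the
result lies in that space again.\<close>
lemma P0_mixed:
  assumes "L b = 0" shows "P0 (tp b s e) = 0"
proof -
  have "tp b (P0 s) e = 0"
    using orth_right[OF L_P0] sym by metis
  then have eq: "tp b s e = tp b (P1 s) e"
    using orth_Q[OF assms] peirce_decomposition[of s]
    by (metis add2 add.right_neutral add.left_neutral)
  \<comment> \<open>By \<open>L_triple\<close> the eigenvalues combine to 0 - 1/2 + 1 = 1/2, a root
    of the polynomial defining \<open>P0\<close>.\<close>
  have "L (tp b (P1 s) e) = tp b (P1 s) e - (1/2) *\<^sub>R tp b (P1 s) e"
    using L_triple[of b "P1 s" e] assms tripotent L_P1[of s]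
    by (simp add: L_def linear_simps)
  also have "\<dots> = (1/2) *\<^sub>R tp b (P1 s) e"
    using scaleR_left_diff_distrib[of 1 "1/2" "tp b (P1 s) e"] by simp
  finally have "L (tp b (P1 s) e) = (1/2) *\<^sub>R tp b (P1 s) e" .
  then have "P0 (tp b (P1 s) e) = (1 - 3/2 + 2/4) *\<^sub>R tp b (P1 s) e"
    unfolding P0_def scaleR_add_left scaleR_left_diff_distrib by (simp add: LQ_simps)
  then show ?thesis
    unfolding eq by simp
qed

text \<open>By \<open>L_triple\<close>, \<open>tp b b\<close> commutes with \<open>L\<close>, hence
  with every polynomial in \<open>L\<close>.\<close>

lemma P0_commute:
  assumes "L b = 0" shows "tp b b (P0 x) = P0 (tp b b x)"
  by (simp add: P0_def L_triple assms linear_simps)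

section \<open>The projection onto index 2, skew-symmetry and the derivation law at
  \<open>e\<close>\<close>

lemma peirce_P2_eq: "peirce_P2 cs tp e x = Q (Q x)"
  unfolding peirce_P2_def
proof (rule the_equality)
  have half: "cs (1/2) y = (1/2) *\<^sub>R y" and one: "cs 1 y = y" and nil: "cs 0 y = 0" for y
    using cs_real[of "1/2" y] cs_real[of 1 y] cs_real[of 0 y] by simp_all
  have mem: "y \<in> peirce_space cs tp 2 e \<longleftrightarrow> L y = y" "y \<in> peirce_space cs tp 1 e \<longleftrightarrow> L y = (1/2) *\<^sub>R y"
     "y \<in> peirce_space cs tp 0 e \<longleftrightarrow> L y = 0" for y
    by (simp_all add: peirce_space_def L_def half one nil)
  show "Q (Q x) \<in> peirce_space cs tp 2 e \<and>
    (\<exists>y1 y0. y1 \<in> peirce_space cs tp 1 e \<and> y0 \<in> peirce_space cs tp 0 e \<and> x = Q (Q x) + y1 + y0)"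
    unfolding mem using L_Q L_P1 L_P0 peirce_decomposition by blast
  fix y
  assume "y \<in> peirce_space cs tp 2 e \<and>
    (\<exists>y1 y0. y1 \<in> peirce_space cs tp 1 e \<and> y0 \<in> peirce_space cs tp 0 e \<and> x = y + y1 + y0)"
  then obtain y1 y0 where "L y = y" "L y1 = (1/2) *\<^sub>R y1" "L y0 = 0" "x = y + y1 + y0"
    unfolding mem by blast
  \<comment> \<open>Uniqueness: 2t^2 - t takes the values 1, 0, 0 at t = 1, 1/2, 0, so applying it
    to the decomposition leaves only \<open>y\<close>.\<close>
  then show "y = Q (Q x)"
    by (simp add: Q_Q LQ_simps linear_0[OF L_linear] algebra_simps scaleR_2)
qed

text \<open>Since \<open>L\<close> fixes the range of \<open>Q\<close>, the third power of
  \<open>Q\<close> is \<open>Q\<close>; hence the involution sends the index 2 part of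
  \<open>x\<close> to \<open>Q x\<close>.\<close>

lemma skew_iff: "peirce_star tp e (peirce_P2 cs tp e x) = - peirce_P2 cs tp e x \<longleftrightarrow> Q x = - Q (Q x)"
proof -
  have "Q (Q (Q x)) = Q x"
    using Q_Q[of "Q x"] by (simp add: L_Q scaleR_2)
  then show ?thesis
    by (simp add: peirce_star_def peirce_P2_eq flip: Q_def)
qed

text \<open>For \<open>x = T e\<close> the left side is the derivation law at the triple
  \<open>e, e, e\<close>. It constrains no index 1 part, since 2t - 1 vanishes at t = 1/2 and
  \<open>Q\<close> kills that part.\<close>

lemma cube_derivable_iff:
  "x = 2 *\<^sub>R L x + Q x \<longleftrightarrow> P0 x = 0 \<and> Q x = - Q (Q x)"
proof
  assume eq: "x = 2 *\<^sub>R L x + Q x"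
  then have "Q x = Q (2 *\<^sub>R L x + Q x)"
    by simp
  also have "\<dots> = 2 *\<^sub>R Q x + Q (Q x)"
    by (simp add: LQ_simps Q_L)
  finally have skew: "Q x = - Q (Q x)"
    by (simp add: scaleR_2 eq_neg_iff_add_eq_0)
  have "P0 x = x - (2 *\<^sub>R L x - Q (Q x))"
    by (simp add: P0_def Q_Q scaleR_2 scaleR_3)
  with eq skew show "P0 x = 0 \<and> Q x = - Q (Q x)"
    by (metis diff_minus_eq_add minus_minus diff_self)
next
  assume asm: "P0 x = 0 \<and> Q x = - Q (Q x)"
  have "P0 x = x - (2 *\<^sub>R L x - Q (Q x))"
    by (simp add: P0_def Q_Q scaleR_2 scaleR_3)
  with asm show "x = 2 *\<^sub>R L x + Q x"
    by (metis add_uminus_conv_diff eq_iff_diff_eq_0)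
qed

lemma P0_derivable_eq_0:
  assumes orth: "triple_derivable_orth tp T"
    and cube: "\<And>a. tp a a a = 0 \<Longrightarrow> a = 0"
  shows "P0 (T e) = 0"
proof (rule cube)
  define b where "b = P0 (T e)"
  have b: "L b = 0"
    by (simp add: b_def L_P0)
  have "tp (T e) b b + tp e (T b) b + tp e b (T b) = 0"
    using orth orth_right[OF b] by (simp add: triple_derivable_orth_def triple_orth_def)
  then have "tp b b (T e) = - tp b (T b) e"
    using orth_right[OF b] sym by (metis add.right_neutral eq_neg_iff_add_eq_0)
  \<comment> \<open>\<open>P0\<close> passes through \<open>tp b b\<close> on the left, while
    \<open>P0_mixed\<close> annihilates the right side.\<close>
  then have "tp b b (P0 (T e)) = P0 (- tp b (T b) e)"
    by (simp add: P0_commute[OF b])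
  also have "\<dots> = - P0 (tp b (T b) e)"
    by (simp add: P0_def LQ_simps)
  finally show "tp (P0 (T e)) (P0 (T e)) (P0 (T e)) = 0"
    by (simp add: P0_mixed[OF b] flip: b_def)
qed

end

section \<open>The derivation defect\<close>

definition derivation_defect :: "('a::banach \<Rightarrow> 'a \<Rightarrow> 'a \<Rightarrow> 'a) \<Rightarrow> ('a \<Rightarrow> 'a) \<Rightarrow> 'a \<Rightarrow> 'a \<Rightarrow> 'a \<Rightarrow> 'a" where
  "derivation_defect tp T a b c = T (tp a b c) - (tp (T a) b c + tp a (T b) c + tp a b (T c))"

text \<open>Complex linearity of \<open>T\<close> preserves each sesquilinear law; exchanging the
  outer variables swaps the terms with \<open>T\<close> in the first and third place.\<close>

lemma (in triple_form) triple_form_derivation_defect: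
  assumes "clinear_map cs T"
  shows "triple_form cs (derivation_defect tp T)"
proof
  have cs_diff: "cs \<mu> (u - v) = cs \<mu> u - cs \<mu> v" for \<mu> u v
    using cs_add[of \<mu> "u - v" v] by (simp add: algebra_simps)
  have T: "T (x + y) = T x + T y" "T (cs \<mu> x) = cs \<mu> (T x)" for x y \<mu>
    using assms by (simp_all add: clinear_map_def)
  show "complex_scaling cs"
    by (rule scaling)
  fix a a' b b' c \<mu>
  show "derivation_defect tp T (a + a') b c = derivation_defect tp T a b c + derivation_defect tp T a' b c"
    and "derivation_defect tp T a (b + b') c = derivation_defect tp T a b c + derivation_defect tp T a b' c"
    by (simp_all add: derivation_defect_def T linear_simps algebra_simps)
  show "derivation_defect tp T (cs \<mu> a) b c = cs \<mu> (derivation_defect tp T a b c)"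
    and "derivation_defect tp T a (cs \<mu> b) c = cs (cnj \<mu>) (derivation_defect tp T a b c)"
    by (simp_all add: derivation_defect_def T cs1 cs2 cs_add cs_diff)
  show "derivation_defect tp T a b c = derivation_defect tp T c b a"
    using sym[of a b c] sym[of "T a" b c] sym[of a "T b" c] sym[of a b "T c"]
    by (simp add: derivation_defect_def)
qed

lemma (in jordan_tripotent) derivation_defect_tripotent:
  "derivation_defect tp T e e e = 0 \<longleftrightarrow> P0 (T e) = 0 \<and> Q (T e) = - Q (Q (T e))"
proof -
  have "derivation_defect tp T e e e = T e - (2 *\<^sub>R L (T e) + Q (T e))"
    using sym[of "T e" e e] by (simp add: derivation_defect_def tripotent L_def Q_def scaleR_2)
  then show ?thesis
    using cube_derivable_iff[of "T e"] by simp
qed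

section \<open>Equivalence by density of orthogonal combinations of tripotents\<close>

theorem mainTheorem11:
  fixes cs :: "complex \<Rightarrow> 'a::banach \<Rightarrow> 'a"
    and tp :: "'a \<Rightarrow> 'a \<Rightarrow> 'a \<Rightarrow> 'a"
    and T :: "'a \<Rightarrow> 'a"
  assumes "jbstar_triple cs tp"
    and "tripotents_norm_total cs tp"
    and "bounded_clinear_map cs T"
  shows "triple_derivation tp T \<longleftrightarrow>
           (triple_derivable_orth tp T \<and>
            (\<forall>e. tripotent tp e \<longrightarrow>
               peirce_star tp e (peirce_P2 cs tp e (T e)) = - peirce_P2 cs tp e (T e)))"
proof -
  interpret jordan_triple cs tp
    by unfold_locales (use assms(1) in \<open>unfold jbstar_triple_def, iprover\<close>)+
  have tpt: "jordan_tripotent cs tp e" if "tripotent tp e" for e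
    using that by unfold_locales (simp add: tripotent_def)
  have T: "clinear_map cs T"
    using assms(3) by (simp add: bounded_clinear_map_def)
  interpret D: triple_form cs "derivation_defect tp T"
    using T by (rule triple_form_derivation_defect)
  have T_add: "T (x + y) = T x + T y" for x y
    using T by (simp add: clinear_map_def)
  then have T_0: "T 0 = 0"
    by (metis add_cancel_left_left)
  \<comment> \<open>The norm identity for cubes excludes nonzero elements with zero cube.\<close>
  have anisotropic: "a = 0" if "tp a a a = 0" for a
    using assms(1) that by (metis jbstar_triple_def norm_eq_zero power_eq_0_iff)
  have deriv_iff: "triple_derivation tp T \<longleftrightarrow> (\<forall>a b c. derivation_defect tp T a b c = 0)"
    by (simp add: triple_derivation_def derivation_defect_def)
  have cont: "continuous_on UNIV (\<lambda>a. derivation_defect tp T a a a)"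
  proof -
    obtain K where "\<And>x. norm (T x) \<le> K * norm x"
      using assms(3) by (auto simp: bounded_clinear_map_def)
    moreover have "T (r *\<^sub>R x) = r *\<^sub>R T x" for r x
      using T by (metis clinear_map_def cs_real)
    ultimately have "bounded_linear T"
      by (intro bounded_linear_intro[where K = K]) (simp_all add: T_add mult.commute)
    then have T_cont: "continuous_on UNIV (\<lambda>x. T (f x))" if "continuous_on UNIV f" for f :: "'a \<Rightarrow> 'a"
      using that by (rule bounded_linear.continuous_on)
    have tp_cont: "continuous_on UNIV (\<lambda>x. tp (f x) (g x) (h x))"
      if "continuous_on UNIV f" "continuous_on UNIV g" "continuous_on UNIV h" for f g h :: "'a \<Rightarrow> 'a"
    proof -
      have "continuous_on UNIV (\<lambda>(a, b, c). tp a b c)"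
        using assms(1) by (simp add: jbstar_triple_def)
      then have "continuous_on UNIV (\<lambda>x. (\<lambda>(a, b, c). tp a b c) (f x, g x, h x))"
        by (rule continuous_on_compose2) (use that in \<open>auto intro!: continuous_intros\<close>)
      then show ?thesis by simp
    qed
    show ?thesis
      unfolding derivation_defect_def by (intro continuous_intros T_cont tp_cont)
  qed
  show ?thesis
  proof
    assume deriv: "triple_derivation tp T"
    \<comment> \<open>On an orthogonal pair the left side of the derivation law is
      \<open>T 0 = 0\<close>.\<close>
    have "triple_derivable_orth tp T"
      unfolding triple_derivable_orth_def triple_orth_def
      using deriv T_0 by (metis triple_derivation_def)
    moreover have "peirce_star tp e (peirce_P2 cs tp e (T e)) = - peirce_P2 cs tp e (T e)"
      if "tripotent tp e" for e
    proof -
      interpret jordan_tripotent cs tp e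
        using that by (rule tpt)
      show ?thesis
        using deriv deriv_iff derivation_defect_tripotent skew_iff by blast
    qed
    ultimately show "triple_derivable_orth tp T \<and> (\<forall>e. tripotent tp e \<longrightarrow>
        peirce_star tp e (peirce_P2 cs tp e (T e)) = - peirce_P2 cs tp e (T e))"
      by blast
  next
    assume asm: "triple_derivable_orth tp T \<and> (\<forall>e. tripotent tp e \<longrightarrow>
        peirce_star tp e (peirce_P2 cs tp e (T e)) = - peirce_P2 cs tp e (T e))"
    have diag: "derivation_defect tp T e e e = 0" if "tripotent tp e" for e
    proof -
      interpret jordan_tripotent cs tp e
        using that by (rule tpt)
      show ?thesis
        \<comment> \<open>Orthogonal derivability removes the index 0 part of \<open>T e\<close>;
          the skewness hypothesis handles the index 2 part.\<close>
        using asm that P0_derivable_eq_0 anisotropic derivation_defect_tripotent skew_iff by blast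
    qed
    have off: "derivation_defect tp T a b c = 0" if "triple_orth tp a b" for a b c
      using asm that T_0 by (simp add: derivation_defect_def triple_derivable_orth_def triple_orth_def)
    have "derivation_defect tp T a a a = 0" for a
    \<comment> \<open>The cube of the defect is continuous, so its vanishing on the dense set
      \<open>?S\<close> suffices.\<close>
    proof (rule continuous_constant_on_closure[where f = "\<lambda>a. derivation_defect tp T a a a"])
      let ?S = "{y. \<exists>(n::nat) (c::nat \<Rightarrow> complex) (u::nat \<Rightarrow> 'a).
          (\<forall>i<n. tripotent tp (u i)) \<and>
          (\<forall>i<n. \<forall>j<n. i \<noteq> j \<longrightarrow> triple_orth tp (u i) (u j)) \<and>
          y = (\<Sum>i<n. cs (c i) (u i))}"
      show "continuous_on (closure ?S) (\<lambda>a. derivation_defect tp T a a a)"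
        using cont continuous_on_subset by blast
      show "a \<in> closure ?S"
        using assms(2) unfolding tripotents_norm_total_def by blast
      fix y assume "y \<in> ?S"
      then obtain n c u where u: "\<And>i. i < n \<Longrightarrow> tripotent tp (u i)"
          "\<And>i j. i < n \<Longrightarrow> j < n \<Longrightarrow> i \<noteq> j \<Longrightarrow> triple_orth tp (u i) (u j)"
        and y: "y = (\<Sum>i<(n::nat). cs (c i) (u i))"
        by blast
      show "derivation_defect tp T y y y = 0"
        unfolding y by (rule D.cube_of_combination_eq_0) (auto intro: off diag u)
    qed
    then show "triple_derivation tp T"
      using D.polarization deriv_iff by blast
  qed
qed

end
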